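(* Let $\mathcal{K}\subseteq\mathcal{N}_G$ be a subset of generation buses each of which has a single connection (exactly one neighbor in $\mathcal{G}$). Consider the storage placement problem $P$, the restricted storage placement problem $\Pi^{\mathcal{K}}$, and their respective optimal costs $p_*$ and $\pi_*^{\mathcal{K}}$. If $P$ is feasible, then $\Pi^{\mathcal{K}}$ is feasible and $p_*=\pi_*^{\mathcal{K}}$.
   Context: Network. $\mathcal{G}$ is an undirected connected (simple) graph on the set of buses $\mathcal{N}=\{1,\dots,n\}$; $k\sim l$ means that $k$ and $l$ are joined by a transmission line. Each bus has either generation or load but not both: $\mathcal{N}$ is partitioned into nonempty sets $\mathcal{N}_G$ (generation-only buses) and $\mathcal{N}_D$ (load-only buses). A bus has a single connection if it has exactly one neighbor in $\mathcal{G}$. Data. $T\ge 1$ is an integer and $[T]=\{1,\dots,T\}$. $d_k(t)\in\mathbb{R}$, $t\in[T]$, is the given demand at bus $k$, with $d_k(t)=0$ for $k\in\mathcal{N}_G$. $\overline{g}_k\ge 0$ is the generation capacity at bus $k$, with $\overline{g}_k=0$ for $k\in\mathcal{N}_D$. $c_k:\mathbb{R}^+\to\mathbb{R}^+$ is a convex nondecreasing cost function for each $k$ (where $\mathbb{R}^+=[0,\infty)$). For each line $k\sim l$, $f_{kl}=f_{lk}\ge 0$ is its capacity and $B_{kl}=B_{lk}\neq 0$ its susceptance. $\alpha_\gamma,\alpha_\delta\in(0,1]$ are the charging and discharging efficiencies, $\epsilon_\gamma\in(0,1/\alpha_\gamma]$ and $\epsilon_\delta\in(0,\alpha_\delta]$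 are ramp constants, and $h\ge 0$ is the storage budget. Problem $P$: minimize $\sum_{k\in\mathcal{N}}\sum_{t=1}^T c_k(g_k(t))$ over real variables $g_k(t),\gamma_k(t),\delta_k(t),\theta_k(t),p_{kl}(t),b_k$ ($k\in\mathcal{N}$, ordered pairs $k\sim l$, $t\in[T]$) subject to, for all $k\in\mathcal{N}$, $l\sim k$, $t\in[T]$: - $0\le g_k(t)\le\overline{g}_k$; - $|p_{kl}(t)|\le f_{kl}$ and $p_{kl}(t)=B_{kl}[\theta_k(t)-\theta_l(t)]$; - $g_k(t)-d_k(t)-\gamma_k(t)+\delta_k(t)=\sum_{l\sim k}p_{kl}(t)$; - $0\le s_k(t)\le b_k$, where $s_k(t):=\sum_{\tau=1}^t\left(\alpha_\gamma\gamma_k(\tau)-\frac{1}{\alpha_\delta}\delta_k(\tau)\right)$ is the storage level (initially $s_k^0=0$), and $s_k(T)=0$; - $0\le\gamma_k(t)\le\epsilon_\gamma b_k$ and $0\le\delta_k(t)\le\epsilon_\delta b_k$; - $b_k\ge 0$ and $\sum_{k\in\mathcal{N}}b_k\le h$. Problem $\Pi^{\mathcal{K}}$ (for $\mathcal{K}\subseteq\mathcal{N}_G$): the same problem with the additional constraints $b_k=0$ for all $k\in\mathcal{K}$. The optimal values of $P$ and $\Pi^{\mathcal{K}}$ are $p_*$ and $\pi_*^{\mathcal{K}}$. *)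

theory Defs
  imports "HOL-Analysis.Analysis" "Graph_Theory.Graph_Theory"
begin

text \<open>
  The grid is an undirected simple graph in the sense of \<^locale>\<open>pair_graph\<close>: every transmission
  line is represented by its two arcs \<open>(k, l)\<close> and \<open>(l, k)\<close>. Times range over \<open>{1..horizon}\<close>.
  Values of the data at indices that are not buses, not lines or not in the horizon are irrelevant.
\<close>

record network =
  num_buses :: nat
  grid :: "nat pair_pre_digraph"
  gen_buses :: "nat set"
  load_buses :: "nat set"
  horizon :: nat
  demand :: "nat \<Rightarrow> nat \<Rightarrow> real"  \<comment> \<open>bus, time\<close>
  gen_cap :: "nat \<Rightarrow> real"
  gen_cost :: "nat \<Rightarrow> real \<Rightarrow> real"
  line_cap :: "nat \<Rightarrow> nat \<Rightarrow> real"
  susceptance :: "nat \<Rightarrow> nat \<Rightarrow> real"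
  eff_charge :: real
  eff_discharge :: real
  ramp_charge :: real
  ramp_discharge :: real
  budget :: real

abbreviation buses :: "network \<Rightarrow> nat set" where
  "buses N \<equiv> pverts (grid N)"

definition neighbors :: "network \<Rightarrow> nat \<Rightarrow> nat set" where
  "neighbors N k = {l. (k, l) \<in> parcs (grid N)}"

definition single_connection :: "network \<Rightarrow> nat \<Rightarrow> bool" where
  "single_connection N k \<longleftrightarrow> card (neighbors N k) = 1"

locale storage_network =
  fixes N :: network
  assumes grid_graph: "pair_graph (grid N)"
    and buses_eq: "buses N = {1..num_buses N}"
    and grid_connected: "Digraph_Component.connected (with_proj (grid N))"
    and buses_partition: "gen_buses N \<union> load_buses N = buses N"
      "gen_buses N \<inter> load_buses N = {}"
    and gen_buses_nonempty: "gen_buses N \<noteq> {}"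
    and load_buses_nonempty: "load_buses N \<noteq> {}"
    and horizon_pos: "horizon N \<ge> 1"
    and demand_gen: "\<And>k t. k \<in> gen_buses N \<Longrightarrow> t \<in> {1..horizon N} \<Longrightarrow> demand N k t = 0"
    and gen_cap_nonneg: "\<And>k. k \<in> buses N \<Longrightarrow> gen_cap N k \<ge> 0"
    and gen_cap_load: "\<And>k. k \<in> load_buses N \<Longrightarrow> gen_cap N k = 0"
    and gen_cost_nonneg: "\<And>k x. k \<in> buses N \<Longrightarrow> x \<ge> 0 \<Longrightarrow> gen_cost N k x \<ge> 0"
    and gen_cost_convex: "\<And>k. k \<in> buses N \<Longrightarrow> convex_on {0..} (gen_cost N k)"
    and gen_cost_mono: "\<And>k. k \<in> buses N \<Longrightarrow> mono_on {0..} (gen_cost N k)"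
    and line_cap_sym: "\<And>k l. (k, l) \<in> parcs (grid N) \<Longrightarrow> line_cap N k l = line_cap N l k"
    and line_cap_nonneg: "\<And>k l. (k, l) \<in> parcs (grid N) \<Longrightarrow> line_cap N k l \<ge> 0"
    and susceptance_sym:
      "\<And>k l. (k, l) \<in> parcs (grid N) \<Longrightarrow> susceptance N k l = susceptance N l k"
    and susceptance_nonzero: "\<And>k l. (k, l) \<in> parcs (grid N) \<Longrightarrow> susceptance N k l \<noteq> 0"
    and eff_charge_range: "eff_charge N \<in> {0<..1}"
    and eff_discharge_range: "eff_discharge N \<in> {0<..1}"
    and ramp_charge_range: "ramp_charge N \<in> {0<..1 / eff_charge N}"
    and ramp_discharge_range: "ramp_discharge N \<in> {0<..eff_discharge N}"
    and budget_nonneg: "budget N \<ge> 0"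

record decision =
  generation :: "nat \<Rightarrow> nat \<Rightarrow> real"
  charge :: "nat \<Rightarrow> nat \<Rightarrow> real"
  discharge :: "nat \<Rightarrow> nat \<Rightarrow> real"
  angle :: "nat \<Rightarrow> nat \<Rightarrow> real"
  flow :: "nat \<Rightarrow> nat \<Rightarrow> nat \<Rightarrow> real"  \<comment> \<open>sending bus, receiving bus, time\<close>
  storage_cap :: "nat \<Rightarrow> real"

definition storage_level :: "network \<Rightarrow> decision \<Rightarrow> nat \<Rightarrow> nat \<Rightarrow> real" where
  "storage_level N x k t =
     (\<Sum>\<tau> = 1..t. eff_charge N * charge x k \<tau> - 1 / eff_discharge N * discharge x k \<tau>)"

definition feasible_P :: "network \<Rightarrow> decision \<Rightarrow> bool" where
  "feasible_P N x \<longleftrightarrow>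
     (\<forall>k \<in> buses N. \<forall>t \<in> {1..horizon N}.
        0 \<le> generation x k t \<and> generation x k t \<le> gen_cap N k \<and>
        (\<forall>l \<in> neighbors N k.
           \<bar>flow x k l t\<bar> \<le> line_cap N k l \<and>
           flow x k l t = susceptance N k l * (angle x k t - angle x l t)) \<and>
        generation x k t - demand N k t - charge x k t + discharge x k t
          = (\<Sum>l \<in> neighbors N k. flow x k l t) \<and>
        0 \<le> storage_level N x k t \<and> storage_level N x k t \<le> storage_cap x k \<and>
        0 \<le> charge x k t \<and> charge x k t \<le> ramp_charge N * storage_cap x k \<and>
        0 \<le> discharge x k t \<and> discharge x k t \<le> ramp_discharge N * storage_cap x k) \<and>
     (\<forall>k \<in> buses N. storage_level N x k (horizon N) = 0 \<and> storage_cap x k \<ge> 0) \<and>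
     (\<Sum>k \<in> buses N. storage_cap x k) \<le> budget N"

definition feasible_Pi :: "network \<Rightarrow> nat set \<Rightarrow> decision \<Rightarrow> bool" where
  "feasible_Pi N K x \<longleftrightarrow> feasible_P N x \<and> (\<forall>k \<in> K. storage_cap x k = 0)"

definition total_cost :: "network \<Rightarrow> decision \<Rightarrow> real" where
  "total_cost N x = (\<Sum>k \<in> buses N. \<Sum>t = 1..horizon N. gen_cost N k (generation x k t))"

text \<open>Infima are taken in the extended reals, so an infeasible problem has optimal value \<open>\<infinity>\<close>.\<close>

definition opt_P :: "network \<Rightarrow> ereal" where
  "opt_P N = (INF x \<in> {x. feasible_P N x}. ereal (total_cost N x))"

definition opt_Pi :: "network \<Rightarrow> nat set \<Rightarrow> ereal" where
  "opt_Pi N K = (INF x \<in> {x. feasible_Pi N K x}. ereal (total_cost N x))"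

end

theory Submission
  imports Defs
begin

text \<open>
  Let \<open>k\<close> be a generation bus whose only neighbor is \<open>l\<close>. The storage of \<open>k\<close> can be moved to \<open>l\<close>
  without changing anything in the rest of the network as soon as the generation at \<open>k\<close> respects
  the line capacity \<open>f = f\<^sub>k\<^sub>l\<close>, because then the generated power can be sent over the line directly.
  Generation above \<open>f\<close> was necessarily charged into the storage of \<open>k\<close>. It is cut down to \<open>f\<close>; the
  resulting deficit in the storage is made up by discharging less, and hence generating more, at
  other times when the generation stays below \<open>f\<close>. As the efficiencies are at most 1, the total
  generation does not increase, so by convexity and monotonicity the cost does not increase either.
  The neighbor \<open>l\<close> is not in \<open>K\<close>, as otherwise \<open>k\<close> and \<open>l\<close> would be the whole network and
  there would be no load bus. So the buses in \<open>K\<close> can be treated one after the other.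
\<close>

section \<open>Capping the generation at a bus with storage\<close>

text \<open>The constant \<open>s\<close> is the right derivative of \<open>c\<close> at \<open>f\<close>.\<close>

lemma convex_mono_increment_bound:
  fixes c :: "real \<Rightarrow> real" and f :: real
  assumes cvx: "convex_on {0..} c" and mono: "mono_on {0..} c" and f: "0 \<le> f"
  obtains s where "0 \<le> s"
    "\<And>u v. 0 \<le> u \<Longrightarrow> min u f \<le> v \<Longrightarrow> v \<le> f \<Longrightarrow> c v - c u \<le> s * (v - u)"
proof -
  define q where "q = (\<lambda>w. (c w - c f) / (w - f))"
  define s where "s = (INF w\<in>{f<..}. q w)"
  have q_nonneg: "0 \<le> q w" if "w \<in> {f<..}" for w
    using that f mono_onD[OF mono, of f w] by (auto simp: q_def)
  \<comment> \<open>Monotonicity of \<open>c\<close> bounds the slopes \<open>q w\<close> below by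
    0, so their infimum exists.\<close>
  have s_nonneg: "0 \<le> s"
    unfolding s_def by (rule cINF_greatest) (use q_nonneg in auto)
  have s_le: "s \<le> q w" if "w \<in> {f<..}" for w
    unfolding s_def by (rule cINF_lower) (use that q_nonneg in \<open>auto intro!: bdd_belowI2\<close>)
  have "c v - c u \<le> s * (v - u)" if u: "0 \<le> u" "min u f \<le> v" "v \<le> f" for u v
  proof -
    consider "f < u" | "v = u" | "u < v" using u by fastforce
    then show ?thesis
    proof cases
      case 1
      with u have "v = f" by auto
      have "s * (u - f) \<le> c u - c f"
        using s_le[of u] 1 by (simp add: q_def le_divide_eq)
      with \<open>v = f\<close> show ?thesis by (simp add: algebra_simps)
    next
      case 3
      \<comment> \<open>Here \<open>u < v \<le> f < w\<close>, so by convexity the slopes increase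
        from [u, v] to [v, w] and on to [f, w].\<close>
      have "(c v - c u) / (v - u) \<le> q w" if "w \<in> {f<..}" for w
      proof -
        from that have w: "f < w" by simp
        have flip: "(c i - c j) / (i - j) = (c j - c i) / (j - i)" for i j
          by (metis minus_diff_eq minus_divide_divide)
        have "(c v - c u) / (v - u) \<le> (c w - c v) / (w - v)"
          using convex_on_slope_le[OF cvx, of u w v] u 3 w flip[of u] flip[of v w] by auto
        also have "\<dots> \<le> q w"
        proof (cases "v = f")
          case False
          with convex_on_slope_le(2)[OF cvx, of v w f] u 3 w show ?thesis
            using flip[of v w] flip[of f w] by (auto simp: q_def)
        qed (simp add: q_def)
        finally show ?thesis .
      qed
      then have "(c v - c u) / (v - u) \<le> s"
        unfolding s_def by (intro cINF_greatest) auto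
      with 3 show ?thesis by (simp add: divide_le_eq)
    qed simp
  qed
  with s_nonneg that show thesis by blast
qed

text \<open>
  Here \<open>D\<close> is how far the new storage level lies below the old one, \<open>S\<close> and \<open>S'\<close> are the old
  storage level before and after the time step, and \<open>x\<close>, \<open>y\<close> are the reductions of charge and
  discharge. The solution is found on the segment from \<open>(e, 0)\<close> to
  \<open>(min \<gamma> (\<delta> + e), \<delta>)\<close>, where \<open>e\<close> is the excess of the generation over \<open>f\<close>.
\<close>

lemma capped_step:
  fixes a \<beta> :: real
  assumes a: "0 < a" and \<gamma>: "0 \<le> \<gamma>" and \<delta>: "0 \<le> \<delta>" and p: "g - \<gamma> + \<delta> \<le> f"
    and D: "0 \<le> D" "D \<le> S" and S': "S' = S + (a * \<gamma> - \<beta> * \<delta>)" "0 \<le> S'"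
  obtains x y where "0 \<le> x" "x \<le> \<gamma>" "0 \<le> y" "y \<le> \<delta>"
    "min g f \<le> g - x + y" "g - x + y \<le> f"
    "0 \<le> D + (a * x - \<beta> * y)" "D + (a * x - \<beta> * y) \<le> S'"
proof -
  define e where "e = max 0 (g - f)"
  \<comment> \<open>The term \<open>\<delta> + e\<close> keeps the generation from falling below
    \<open>min g f\<close> once all discharge is cancelled; the term \<open>\<gamma>\<close> keeps
    the new charge nonnegative.\<close>
  define X where "X = min \<gamma> (\<delta> + e)"
  have e: "0 \<le> e" "e \<le> \<gamma>" "g - e = min g f" and X: "e \<le> X" "X \<le> \<gamma>"
    using p \<gamma> \<delta> by (auto simp: e_def X_def)
  have gX: "min g f \<le> g - X + \<delta>" "g - X + \<delta> \<le> f"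
    using p by (auto simp: e_def X_def)
  \<comment> \<open>At the far end of the segment the deficit fits, because \<open>D \<le> S\<close>
    and \<open>X \<le> \<gamma>\<close>.\<close>
  have D1: "D + (a * X - \<beta> * \<delta>) \<le> S'"
    using D S' mult_left_mono[OF X(2), of a] a by linarith
  have D0: "0 \<le> D + a * e" using D e a by simp
  show thesis
  proof (cases "D + a * e \<le> S'")
    case True
    with D0 e \<gamma> \<delta> show thesis by (intro that[of e 0]) auto
  next
    case False
    \<comment> \<open>The deficit is affine along the segment, above \<open>S'\<close> at its start
      and at most \<open>S'\<close> at its end. At parameter \<open>m\<close> it equals
      \<open>S'\<close>, that is, the new storage runs exactly empty.\<close>
    define m where "m = (D + a * e - S') / (D + a * e - (D + (a * X - \<beta> * \<delta>)))"
    have m: "0 \<le> m" "m \<le> 1" using False D1 by (auto simp: m_def divide_le_eq)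
    have "m * (D + a * e - (D + (a * X - \<beta> * \<delta>))) = D + a * e - S'"
      using False D1 by (simp add: m_def)
    then have hit: "D + (a * (e + m * (X - e)) - \<beta> * (m * \<delta>)) = S'"
      by (simp add: algebra_simps)
    have "m * (X - e) \<le> X - e" using m X by (simp add: mult_left_le_one_le)
    moreover have "m * \<delta> \<le> \<delta>" using m \<delta> by (simp add: mult_left_le_one_le)
    moreover have "g - (e + m * (X - e)) + m * \<delta> = (1 - m) * min g f + m * (g - X + \<delta>)"
      unfolding e(3)[symmetric] by (simp add: algebra_simps)
    moreover have "min g f \<le> (1 - m) * min g f + m * (g - X + \<delta>)"
      using mult_left_mono[OF gX(1) m(1)] by (simp add: algebra_simps)
    moreover have "(1 - m) * min g f + m * (g - X + \<delta>) \<le> f"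
      using m gX by (intro convex_bound_le) auto
    ultimately show thesis
      using hit S'(2) m X e \<delta>
      by (intro that[of "e + m * (X - e)" "m * \<delta>"]) auto
  qed
qed

section \<open>Reductions along the whole horizon\<close>

text \<open>Induction on \<open>n\<close>, one \<open>capped_step\<close> at a time and without
  looking ahead: that the deficit lies between 0 and the old storage level is both what a step
  requires and what it preserves.\<close>

lemma capped_schedule_reduction:
  fixes a \<beta> :: real and g \<gamma> \<delta> :: "nat \<Rightarrow> real"
  assumes a: "0 < a"
    and "\<And>t. t \<in> {1..n} \<Longrightarrow> 0 \<le> \<gamma> t"
    and "\<And>t. t \<in> {1..n} \<Longrightarrow> 0 \<le> \<delta> t"
    and "\<And>t. t \<in> {1..n} \<Longrightarrow> g t - \<gamma> t + \<delta> t \<le> f"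
    and "\<And>t. t \<in> {1..n} \<Longrightarrow> 0 \<le> (\<Sum>\<tau> = 1..t. a * \<gamma> \<tau> - \<beta> * \<delta> \<tau>)"
  shows "\<exists>x y. \<forall>t\<in>{1..n}. 0 \<le> x t \<and> x t \<le> \<gamma> t \<and> 0 \<le> y t \<and> y t \<le> \<delta> t \<and>
    min (g t) f \<le> g t - x t + y t \<and> g t - x t + y t \<le> f \<and>
    0 \<le> (\<Sum>\<tau> = 1..t. a * x \<tau> - \<beta> * y \<tau>) \<and>
    (\<Sum>\<tau> = 1..t. a * x \<tau> - \<beta> * y \<tau>) \<le> (\<Sum>\<tau> = 1..t. a * \<gamma> \<tau> - \<beta> * \<delta> \<tau>)"
  using assms(2-)
proof (induction n)
  case (Suc n)
  let ?S = "\<lambda>t. \<Sum>\<tau> = 1..t. a * \<gamma> \<tau> - \<beta> * \<delta> \<tau>"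
  have Suc_mem: "t \<in> {1..Suc n}" if "t \<in> {1..n}" for t using that by simp
  from Suc.IH[OF Suc.prems[OF Suc_mem]] obtain x y where
    "\<forall>t\<in>{1..n}. 0 \<le> x t \<and> x t \<le> \<gamma> t \<and> 0 \<le> y t \<and> y t \<le> \<delta> t \<and>
    min (g t) f \<le> g t - x t + y t \<and> g t - x t + y t \<le> f \<and>
    0 \<le> (\<Sum>\<tau> = 1..t. a * x \<tau> - \<beta> * y \<tau>) \<and> (\<Sum>\<tau> = 1..t. a * x \<tau> - \<beta> * y \<tau>) \<le> ?S t"
    by blast
  note xy = bspec[OF this]
  define D where "D = (\<Sum>\<tau> = 1..n. a * x \<tau> - \<beta> * y \<tau>)"
  \<comment> \<open>For \<open>n = 0\<close> both sums are empty: deficit and storage level start at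
    0.\<close>
  have D: "0 \<le> D" "D \<le> ?S n"
    using xy[of n] by (cases n; auto simp: D_def)+
  have S: "?S (Suc n) = ?S n + (a * \<gamma> (Suc n) - \<beta> * \<delta> (Suc n))" by simp
  obtain x' y' where *: "0 \<le> x'" "x' \<le> \<gamma> (Suc n)" "0 \<le> y'" "y' \<le> \<delta> (Suc n)"
    "min (g (Suc n)) f \<le> g (Suc n) - x' + y'" "g (Suc n) - x' + y' \<le> f"
    "0 \<le> D + (a * x' - \<beta> * y')" "D + (a * x' - \<beta> * y') \<le> ?S (Suc n)"
    by (rule capped_step[OF a _ _ _ D S, of "g (Suc n)" f]) (use Suc.prems[of "Suc n"] in auto)
  have sum_upd: "(\<Sum>\<tau> = 1..t. a * (x(Suc n := x')) \<tau> - \<beta> * (y(Suc n := y')) \<tau>)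
    = (\<Sum>\<tau> = 1..t. a * x \<tau> - \<beta> * y \<tau>)" if "t \<le> n" for t
    using that by (intro sum.cong) auto
  show ?case
  proof (intro exI ballI)
    fix t assume "t \<in> {1..Suc n}"
    then consider "t \<in> {1..n}" | "t = Suc n" by fastforce
    then show "0 \<le> (x(Suc n := x')) t \<and> (x(Suc n := x')) t \<le> \<gamma> t \<and>
      0 \<le> (y(Suc n := y')) t \<and> (y(Suc n := y')) t \<le> \<delta> t \<and>
      min (g t) f \<le> g t - (x(Suc n := x')) t + (y(Suc n := y')) t \<and>
      g t - (x(Suc n := x')) t + (y(Suc n := y')) t \<le> f \<and>
      0 \<le> (\<Sum>\<tau> = 1..t. a * (x(Suc n := x')) \<tau> - \<beta> * (y(Suc n := y')) \<tau>) \<and>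
      (\<Sum>\<tau> = 1..t. a * (x(Suc n := x')) \<tau> - \<beta> * (y(Suc n := y')) \<tau>) \<le> ?S t"
    proof cases
      case 1
      then show ?thesis using xy[OF 1] sum_upd[of t] by auto
    next
      case 2
      have "(\<Sum>\<tau> = 1..t. a * (x(Suc n := x')) \<tau> - \<beta> * (y(Suc n := y')) \<tau>)
        = D + (a * x' - \<beta> * y')"
        using sum_upd[of n] 2 by (simp add: D_def)
      with * 2 show ?thesis by simp
    qed
  qed
qed simp

text \<open>Subtracting the reductions keeps the net injection. Both schedules end with empty
  storage, so the discharge removed in total is \<open>a * b\<close> times the charge removed in
  total. Hence the total generation does not grow, and a slope bound common to all times turns this
  into a bound on the cost.\<close>

lemma capped_schedule:
  fixes a b :: real and g \<gamma> \<delta> :: "nat \<Rightarrow> real"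
  assumes a: "0 < a" "a \<le> 1" and b: "0 < b" "b \<le> 1"
    and cost: "convex_on {0..} c" "mono_on {0..} c" and f: "0 \<le> f"
    and g: "\<And>t. t \<in> {1..n} \<Longrightarrow> 0 \<le> g t \<and> g t \<le> G"
    and \<gamma>: "\<And>t. t \<in> {1..n} \<Longrightarrow> 0 \<le> \<gamma> t"
    and \<delta>: "\<And>t. t \<in> {1..n} \<Longrightarrow> 0 \<le> \<delta> t"
    and p: "\<And>t. t \<in> {1..n} \<Longrightarrow> g t - \<gamma> t + \<delta> t \<le> f"
    and S: "\<And>t. t \<in> {1..n} \<Longrightarrow> 0 \<le> (\<Sum>\<tau> = 1..t. a * \<gamma> \<tau> - 1 / b * \<delta> \<tau>)"
    and S_end: "(\<Sum>\<tau> = 1..n. a * \<gamma> \<tau> - 1 / b * \<delta> \<tau>) = 0"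
  obtains g' \<gamma>' \<delta>' where
    "\<And>t. t \<in> {1..n} \<Longrightarrow> 0 \<le> g' t \<and> g' t \<le> G \<and> g' t \<le> f"
    "\<And>t. t \<in> {1..n} \<Longrightarrow> 0 \<le> \<gamma>' t \<and> \<gamma>' t \<le> \<gamma> t"
    "\<And>t. t \<in> {1..n} \<Longrightarrow> 0 \<le> \<delta>' t \<and> \<delta>' t \<le> \<delta> t"
    "\<And>t. t \<in> {1..n} \<Longrightarrow> g' t - \<gamma>' t + \<delta>' t = g t - \<gamma> t + \<delta> t"
    "\<And>t. t \<in> {1..n} \<Longrightarrow> 0 \<le> (\<Sum>\<tau> = 1..t. a * \<gamma>' \<tau> - 1 / b * \<delta>' \<tau>) \<and>
       (\<Sum>\<tau> = 1..t. a * \<gamma>' \<tau> - 1 / b * \<delta>' \<tau>) \<le> (\<Sum>\<tau> = 1..t. a * \<gamma> \<tau> - 1 / b * \<delta> \<tau>)"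
    "(\<Sum>t = 1..n. c (g' t)) \<le> (\<Sum>t = 1..n. c (g t))"
proof (cases "G \<le> f")
  \<comment> \<open>The old schedule already respects \<open>f\<close>. In the other case
    \<open>f < G\<close>, so generation raised up to \<open>f\<close> still respects
    \<open>G\<close>.\<close>
  case True
  with g \<gamma> \<delta> S show thesis by (intro that[of g \<gamma> \<delta>]) (auto intro: order_trans)
next
  case False
  from capped_schedule_reduction[OF a(1) \<gamma> \<delta> p S] obtain x y where
    "\<forall>t\<in>{1..n}. 0 \<le> x t \<and> x t \<le> \<gamma> t \<and> 0 \<le> y t \<and> y t \<le> \<delta> t \<and>
      min (g t) f \<le> g t - x t + y t \<and> g t - x t + y t \<le> f \<and>
      0 \<le> (\<Sum>\<tau> = 1..t. a * x \<tau> - 1 / b * y \<tau>) \<and>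
      (\<Sum>\<tau> = 1..t. a * x \<tau> - 1 / b * y \<tau>) \<le> (\<Sum>\<tau> = 1..t. a * \<gamma> \<tau> - 1 / b * \<delta> \<tau>)"
    by blast
  note xy = bspec[OF this]
  define g' where "g' = (\<lambda>t. g t - x t + y t)"
  have level: "(\<Sum>\<tau> = 1..t. a * (\<gamma> \<tau> - x \<tau>) - 1 / b * (\<delta> \<tau> - y \<tau>))
    = (\<Sum>\<tau> = 1..t. a * \<gamma> \<tau> - 1 / b * \<delta> \<tau>) - (\<Sum>\<tau> = 1..t. a * x \<tau> - 1 / b * y \<tau>)" for t
    by (subst sum_subtractf[symmetric]) (simp add: algebra_simps diff_divide_distrib)
  \<comment> \<open>The final deficit is squeezed between 0 and the final storage level, which is
    0.\<close>
  have "(\<Sum>\<tau> = 1..n. a * x \<tau> - 1 / b * y \<tau>) = 0"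
    using xy[of n] S_end by (cases n) auto
  then have bal: "a * sum x {1..n} - 1 / b * sum y {1..n} = 0"
    by (simp only: sum_subtractf sum_distrib_left)
  have "sum y {1..n} = a * b * sum x {1..n}"
    using bal b by (simp add: field_simps)
  moreover have "a * b * sum x {1..n} \<le> 1 * sum x {1..n}"
    using a b xy by (intro mult_right_mono sum_nonneg) (auto simp: mult_le_one)
  ultimately have less: "sum g' {1..n} \<le> sum g {1..n}"
    by (simp add: g'_def sum.distrib sum_subtractf)
  obtain s where s: "0 \<le> s"
    "\<And>u v. 0 \<le> u \<Longrightarrow> min u f \<le> v \<Longrightarrow> v \<le> f \<Longrightarrow> c v - c u \<le> s * (v - u)"
    by (rule convex_mono_increment_bound[OF cost f]) (rule that)
  have "(\<Sum>t = 1..n. c (g' t)) - (\<Sum>t = 1..n. c (g t)) = (\<Sum>t = 1..n. c (g' t) - c (g t))"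
    by (simp add: sum_subtractf)
  \<comment> \<open>The same \<open>s\<close> serves every time, so only the change of the total
    generation matters.\<close>
  also have "\<dots> \<le> (\<Sum>t = 1..n. s * (g' t - g t))"
    using g xy by (intro sum_mono s(2)) (auto simp: g'_def)
  also have "\<dots> = s * (sum g' {1..n} - sum g {1..n})"
    by (simp only: sum_distrib_left[symmetric] sum_subtractf)
  also have "\<dots> \<le> 0" using less s(1) by (simp add: mult_nonneg_nonpos)
  finally have cost_le: "(\<Sum>t = 1..n. c (g' t)) \<le> (\<Sum>t = 1..n. c (g t))" by simp
  have g': "0 \<le> g' t \<and> g' t \<le> G \<and> g' t \<le> f" if "t \<in> {1..n}" for t
    using xy[OF that] g[OF that] f False by (auto simp: g'_def)
  show thesis
  proof (rule that[of g' "\<lambda>t. \<gamma> t - x t" "\<lambda>t. \<delta> t - y t"])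
    show "0 \<le> (\<Sum>\<tau> = 1..t. a * (\<gamma> \<tau> - x \<tau>) - 1 / b * (\<delta> \<tau> - y \<tau>)) \<and>
      (\<Sum>\<tau> = 1..t. a * (\<gamma> \<tau> - x \<tau>) - 1 / b * (\<delta> \<tau> - y \<tau>))
        \<le> (\<Sum>\<tau> = 1..t. a * \<gamma> \<tau> - 1 / b * \<delta> \<tau>)" if "t \<in> {1..n}" for t
      using xy[OF that] unfolding level by auto
  qed (use xy g' cost_le in \<open>auto simp: g'_def\<close>)
qed

section \<open>Moving the storage to the neighbor\<close>

text \<open>Splits off the constraints local to one bus and one time, so that \<open>k\<close>, its
  neighbor and the remaining buses can be checked separately when storage is moved.\<close>

definition bus_feasible :: "network \<Rightarrow> decision \<Rightarrow> nat \<Rightarrow> nat \<Rightarrow> bool" where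
  "bus_feasible N x k t \<longleftrightarrow>
     0 \<le> generation x k t \<and> generation x k t \<le> gen_cap N k \<and>
     (\<forall>l \<in> neighbors N k.
        \<bar>flow x k l t\<bar> \<le> line_cap N k l \<and>
        flow x k l t = susceptance N k l * (angle x k t - angle x l t)) \<and>
     generation x k t - demand N k t - charge x k t + discharge x k t
       = (\<Sum>l \<in> neighbors N k. flow x k l t) \<and>
     0 \<le> storage_level N x k t \<and> storage_level N x k t \<le> storage_cap x k \<and>
     0 \<le> charge x k t \<and> charge x k t \<le> ramp_charge N * storage_cap x k \<and>
     0 \<le> discharge x k t \<and> discharge x k t \<le> ramp_discharge N * storage_cap x k"

lemma feasible_P_iff:
  "feasible_P N x \<longleftrightarrow>
     (\<forall>k \<in> buses N. \<forall>t \<in> {1..horizon N}. bus_feasible N x k t) \<and>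
     (\<forall>k \<in> buses N. storage_level N x k (horizon N) = 0 \<and> storage_cap x k \<ge> 0) \<and>
     (\<Sum>k \<in> buses N. storage_cap x k) \<le> budget N"
  unfolding feasible_P_def bus_feasible_def ..

context storage_network
begin

section \<open>Connectivity of the grid\<close>

lemma finite_buses: "finite (buses N)"
  by (simp add: buses_eq)

lemma neighbors_sym: "l \<in> neighbors N k \<longleftrightarrow> k \<in> neighbors N l"
proof -
  interpret pair_graph "grid N" by (rule grid_graph)
  show ?thesis using graph_symmetric by (auto simp: neighbors_def)
qed

lemma neighbor_in_buses: "l \<in> neighbors N k \<Longrightarrow> l \<in> buses N"
proof -
  interpret pair_graph "grid N" by (rule grid_graph)
  show "l \<in> neighbors N k \<Longrightarrow> l \<in> buses N" using wellformed' by (auto simp: neighbors_def)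
qed

lemma not_self_neighbor: "k \<notin> neighbors N k"
proof -
  interpret pair_graph "grid N" by (rule grid_graph)
  show ?thesis using pair_no_loops[of "(k, k)"] by (auto simp: neighbors_def)
qed

lemma finite_neighbors: "finite (neighbors N k)"
  using finite_buses neighbor_in_buses by (auto intro: finite_subset)

text \<open>Induction along a path: the grid is connected, so each bus is reachable from a chosen
  bus of \<open>A\<close>, and no line leaves \<open>A\<close>.\<close>

lemma neighbor_closed_eq_buses:
  assumes A: "A \<subseteq> buses N" "A \<noteq> {}" "\<And>i. i \<in> A \<Longrightarrow> neighbors N i \<subseteq> A"
  shows "A = buses N"
proof -
  from A obtain i where i: "i \<in> A" by auto
  have "j \<in> A" if "j \<in> buses N" for j
  proof -
    have "(i, j) \<in> rtrancl_on (buses N) ((parcs (grid N))\<^sup>s)"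
      using grid_connected that i A(1) by (auto simp: connected_conv)
    then show ?thesis
    proof (induction rule: rtrancl_on_induct)
      case (step y z)
      have "z \<in> neighbors N y"
        using step(2) neighbors_sym by (auto simp: symcl_def neighbors_def)
      with step A show ?case by auto
    qed (rule i)
  qed
  with A show ?thesis by auto
qed

text \<open>Guarantees that storage moved away from a bus in \<open>K\<close> never lands at a bus
  in \<open>K\<close>.\<close>

lemma neighbor_not_single_generator:
  assumes "K \<subseteq> gen_buses N" "\<And>k. k \<in> K \<Longrightarrow> single_connection N k"
    and "k \<in> K" "neighbors N k = {l}"
  shows "l \<notin> K"
proof
  assume "l \<in> K"
  then obtain m where m: "neighbors N l = {m}"
    using assms(2) unfolding single_connection_def by (meson card_1_singletonE)
  have "m = k" using neighbors_sym[of l k] assms(4) m by auto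
  \<comment> \<open>Each of the two buses has only the other as a neighbor, so the pair is closed
    under neighbors.\<close>
  then have "{k, l} = buses N"
    using m assms \<open>l \<in> K\<close> buses_partition by (intro neighbor_closed_eq_buses) auto
  with assms(1,3) \<open>l \<in> K\<close> have "buses N \<subseteq> gen_buses N" by auto
  with buses_partition load_buses_nonempty show False by auto
qed

section \<open>Moving storage across a single line\<close>

text \<open>The old flow from \<open>k\<close> to \<open>l\<close> equals
  \<open>g' - \<gamma>' + \<delta>'\<close> for the capped schedule. If \<open>k\<close> sends all
  of \<open>g'\<close> and \<open>l\<close> takes over the charge \<open>\<gamma>'\<close> and the
  discharge \<open>\<delta>'\<close>, the power balance at \<open>l\<close> is unchanged.\<close>

lemma move_storage:
  assumes x: "feasible_P N x" and k: "k \<in> gen_buses N" and nb: "neighbors N k = {l}"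
  obtains z where "feasible_P N z" "total_cost N z \<le> total_cost N x" "storage_cap z k = 0"
    "\<And>i. i \<noteq> k \<Longrightarrow> i \<noteq> l \<Longrightarrow> storage_cap z i = storage_cap x i"
proof -
  let ?T = "{1..horizon N}" and ?a = "eff_charge N" and ?b = "eff_discharge N"
  let ?B = "susceptance N k l"
  have kl: "(k, l) \<in> parcs (grid N)" using nb by (auto simp: neighbors_def)
  have k_buses: "k \<in> buses N" using k buses_partition by auto
  have l_buses: "l \<in> buses N" using neighbor_in_buses[of l k] nb by simp
  have lk: "k \<in> neighbors N l" using neighbors_sym[of l k] nb by simp
  have l_ne_k: "l \<noteq> k" using lk not_self_neighbor by blast
  have T_end: "horizon N \<in> ?T" using horizon_pos by simp
  have B: "?B \<noteq> 0" "susceptance N l k = ?B"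
    using susceptance_nonzero[OF kl] susceptance_sym[OF kl] by auto
  have f: "0 \<le> line_cap N k l" "line_cap N l k = line_cap N k l"
    using line_cap_nonneg[OF kl] line_cap_sym[OF kl] by auto
  have x_bus: "bus_feasible N x i t" if "i \<in> buses N" "t \<in> ?T" for i t
    using x that by (simp add: feasible_P_iff)
  have cap_nonneg: "0 \<le> storage_cap x i"
    and level_end: "storage_level N x i (horizon N) = 0" if "i \<in> buses N" for i
    using x that by (auto simp: feasible_P_iff)
  have bal_k: "generation x k t - charge x k t + discharge x k t = flow x k l t"
    if "t \<in> ?T" for t
    using x_bus[OF k_buses that] nb demand_gen[OF k that] by (simp add: bus_feasible_def)
  have flow_k: "\<bar>flow x k l t\<bar> \<le> line_cap N k l"
      "flow x k l t = ?B * (angle x k t - angle x l t)" if "t \<in> ?T" for t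
    using x_bus[OF k_buses that] nb unfolding bus_feasible_def by blast+
  have flow_l: "flow x l k t = - flow x k l t" if "t \<in> ?T" for t
  proof -
    have "flow x l k t = ?B * (angle x l t - angle x k t)"
      using x_bus[OF l_buses that] lk B(2) by (simp add: bus_feasible_def)
    with flow_k(2)[OF that] show ?thesis by (simp add: algebra_simps)
  qed
  have gen_k: "0 \<le> generation x k t \<and> generation x k t \<le> gen_cap N k"
    and charge_k: "0 \<le> charge x k t" and discharge_k: "0 \<le> discharge x k t"
    and level_k: "0 \<le> storage_level N x k t" if "t \<in> ?T" for t
    using x_bus[OF k_buses that] by (simp_all add: bus_feasible_def)
  \<comment> \<open>The left side is the flow from \<open>k\<close> to \<open>l\<close>, as a
    generation bus has no demand.\<close>
  have line_k: "generation x k t - charge x k t + discharge x k t \<le> line_cap N k l"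
    if "t \<in> ?T" for t
    using flow_k(1)[OF that] bal_k[OF that] by simp
  have eff: "0 < ?a" "?a \<le> 1" "0 < ?b" "?b \<le> 1"
    using eff_charge_range eff_discharge_range by auto
  obtain g' \<gamma>' \<delta>' where
    g': "\<And>t. t \<in> ?T \<Longrightarrow> 0 \<le> g' t \<and> g' t \<le> gen_cap N k \<and> g' t \<le> line_cap N k l"
    and \<gamma>': "\<And>t. t \<in> ?T \<Longrightarrow> 0 \<le> \<gamma>' t \<and> \<gamma>' t \<le> charge x k t"
    and \<delta>': "\<And>t. t \<in> ?T \<Longrightarrow> 0 \<le> \<delta>' t \<and> \<delta>' t \<le> discharge x k t"
    and bal': "\<And>t. t \<in> ?T \<Longrightarrow>
      g' t - \<gamma>' t + \<delta>' t = generation x k t - charge x k t + discharge x k t"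
    and level': "\<And>t. t \<in> ?T \<Longrightarrow> 0 \<le> (\<Sum>\<tau> = 1..t. ?a * \<gamma>' \<tau> - 1 / ?b * \<delta>' \<tau>) \<and>
      (\<Sum>\<tau> = 1..t. ?a * \<gamma>' \<tau> - 1 / ?b * \<delta>' \<tau>) \<le> storage_level N x k t"
    and cost': "(\<Sum>t\<in>?T. gen_cost N k (g' t)) \<le> (\<Sum>t\<in>?T. gen_cost N k (generation x k t))"
    by (rule capped_schedule[OF eff gen_cost_convex[OF k_buses] gen_cost_mono[OF k_buses] f(1)
          gen_k charge_k discharge_k line_k level_k[unfolded storage_level_def]
          level_end[OF k_buses, unfolded storage_level_def], folded storage_level_def])
      (assumption+, rule that)
  \<comment> \<open>The new angle at \<open>k\<close> solves the flow equation for
    \<open>g'\<close>; all other angles stay. The capacity of \<open>k\<close> goes to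
    \<open>l\<close> and suffices there, since the schedule taken over has levels, charges and
    discharges bounded by those of \<open>k\<close>.\<close>
  define z where "z = \<lparr>
    generation = (\<lambda>i. if i = k then g' else generation x i),
    charge = (\<lambda>i t. if i = k then 0 else charge x i t + (if i = l then \<gamma>' t else 0)),
    discharge = (\<lambda>i t. if i = k then 0 else discharge x i t + (if i = l then \<delta>' t else 0)),
    angle = (\<lambda>i t. if i = k then angle x l t + g' t / ?B else angle x i t),
    flow = (\<lambda>i j t. if i = k then g' t else if i = l \<and> j = k then - g' t else flow x i j t),
    storage_cap = (\<lambda>i. if i = k then 0 else storage_cap x i + (if i = l then storage_cap x k else 0))\<rparr>"
  have z_level_k: "storage_level N z k t = 0" for t
    by (simp add: storage_level_def z_def)
  have level_l: "storage_level N z l t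
    = storage_level N x l t + (\<Sum>\<tau> = 1..t. ?a * \<gamma>' \<tau> - 1 / ?b * \<delta>' \<tau>)" for t
    using l_ne_k unfolding storage_level_def z_def
    by (subst sum.distrib[symmetric]) (simp add: algebra_simps add_divide_distrib)
  have level_other: "storage_level N z i t = storage_level N x i t" if "i \<noteq> k" "i \<noteq> l" for i t
    using that by (simp add: storage_level_def z_def)
  have ramp: "0 \<le> ramp_charge N" "0 \<le> ramp_discharge N"
    using ramp_charge_range ramp_discharge_range by auto
  have bus_k: "bus_feasible N z k t"
    if t: "t \<in> ?T" for t
    using g'[OF t] demand_gen[OF k t] nb l_ne_k B(1) z_level_k by (simp add: bus_feasible_def z_def)
  have bus_l: "bus_feasible N z l t"
    if t: "t \<in> ?T" for t
  proof -
    have xl: "0 \<le> generation x l t" "generation x l t \<le> gen_cap N l"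
      "\<And>j. j \<in> neighbors N l \<Longrightarrow> \<bar>flow x l j t\<bar> \<le> line_cap N l j \<and>
         flow x l j t = susceptance N l j * (angle x l t - angle x j t)"
      "generation x l t - demand N l t - charge x l t + discharge x l t
        = (\<Sum>j \<in> neighbors N l. flow x l j t)"
      "0 \<le> storage_level N x l t" "storage_level N x l t \<le> storage_cap x l"
      "0 \<le> charge x l t" "charge x l t \<le> ramp_charge N * storage_cap x l"
      "0 \<le> discharge x l t" "discharge x l t \<le> ramp_discharge N * storage_cap x l"
      using x_bus[OF l_buses t] by (auto simp: bus_feasible_def)
    have xk: "storage_level N x k t \<le> storage_cap x k"
      "charge x k t \<le> ramp_charge N * storage_cap x k"
      "discharge x k t \<le> ramp_discharge N * storage_cap x k"
      using x_bus[OF k_buses t] by (auto simp: bus_feasible_def)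
    have flows: "(\<Sum>j \<in> neighbors N l. flow z l j t)
      = - g' t + (\<Sum>j \<in> neighbors N l - {k}. flow x l j t)"
      by (subst sum.remove[OF finite_neighbors lk]) (use l_ne_k in \<open>simp add: z_def\<close>)
    have "(\<Sum>j \<in> neighbors N l. flow x l j t)
      = - flow x k l t + (\<Sum>j \<in> neighbors N l - {k}. flow x l j t)"
      by (subst sum.remove[OF finite_neighbors lk]) (simp add: flow_l[OF t])
    with xl(4) bal'[OF t] bal_k[OF t] flows l_ne_k
    have balance: "generation z l t - demand N l t - charge z l t + discharge z l t
      = (\<Sum>j \<in> neighbors N l. flow z l j t)"
      by (simp add: z_def)
    have lines: "\<bar>flow z l j t\<bar> \<le> line_cap N l j \<and>
         flow z l j t = susceptance N l j * (angle z l t - angle z j t)"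
      if "j \<in> neighbors N l" for j
      using that xl(3)[OF that] g'[OF t] f B l_ne_k by (auto simp: z_def)
    have "0 \<le> storage_level N z l t" "storage_level N z l t \<le> storage_cap z l"
      using level'[OF t] xl(5,6) xk(1) l_ne_k unfolding level_l by (auto simp: z_def)
    moreover have "0 \<le> charge z l t \<and> charge z l t \<le> ramp_charge N * storage_cap z l"
      using \<gamma>'[OF t] xl(7,8) xk(2) l_ne_k by (simp add: z_def distrib_left)
    moreover have "0 \<le> discharge z l t \<and> discharge z l t \<le> ramp_discharge N * storage_cap z l"
      using \<delta>'[OF t] xl(9,10) xk(3) l_ne_k by (simp add: z_def distrib_left)
    moreover have "0 \<le> generation z l t \<and> generation z l t \<le> gen_cap N l"
      using xl(1,2) l_ne_k by (simp add: z_def)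
    ultimately show ?thesis using balance lines unfolding bus_feasible_def by blast
  qed
  have bus_other: "bus_feasible N z i t"
    if i: "i \<in> buses N" "i \<noteq> k" "i \<noteq> l" and t: "t \<in> ?T" for i t
  proof -
    \<comment> \<open>The altered angle at \<open>k\<close> enters only the line equations of
      \<open>k\<close> and \<open>l\<close>.\<close>
    have "k \<notin> neighbors N i" using neighbors_sym[of k i] nb i by auto
    then have "angle z j t = angle x j t" if "j \<in> neighbors N i" for j
      using that by (auto simp: z_def)
    moreover have "generation z i t = generation x i t" "charge z i t = charge x i t"
      "discharge z i t = discharge x i t" "storage_cap z i = storage_cap x i"
      "angle z i t = angle x i t" "\<And>j. flow z i j t = flow x i j t"
      using i by (auto simp: z_def)
    ultimately have "bus_feasible N z i t = bus_feasible N x i t"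
      using level_other[OF i(2,3)] by (simp add: bus_feasible_def)
    with x_bus[OF i(1) t] show ?thesis by simp
  qed
  have caps: "(\<Sum>i \<in> buses N. storage_cap z i) = (\<Sum>i \<in> buses N. storage_cap x i)"
  proof -
    have "(\<Sum>i \<in> buses N. storage_cap z i)
      = (\<Sum>i \<in> buses N. storage_cap x i + (if i = l then storage_cap x k else 0)
          - (if i = k then storage_cap x k else 0))"
      using l_ne_k by (intro sum.cong) (auto simp: z_def)
    also have "\<dots> = (\<Sum>i \<in> buses N. storage_cap x i)"
      using k_buses l_buses finite_buses by (simp add: sum.distrib sum_subtractf)
    finally show ?thesis .
  qed
  have final_level: "storage_level N z i (horizon N) = 0 \<and> storage_cap z i \<ge> 0"
    if "i \<in> buses N" for i
  proof -
    \<comment> \<open>This level lies between 0 and the old final level of \<open>k\<close>, which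
      is 0.\<close>
    have "(\<Sum>\<tau> = 1..horizon N. ?a * \<gamma>' \<tau> - 1 / ?b * \<delta>' \<tau>) = 0"
      using level'[OF T_end] level_end[OF k_buses] by simp
    with level_end that have "storage_level N z i (horizon N) = 0"
      using z_level_k level_l level_other by (cases "i = k"; cases "i = l") auto
    moreover have "storage_cap z i \<ge> 0"
      using cap_nonneg that k_buses by (simp add: z_def)
    ultimately show ?thesis ..
  qed
  have "bus_feasible N z i t" if "i \<in> buses N" "t \<in> ?T" for i t
    using bus_k bus_l bus_other that by (cases "i = k"; cases "i = l") auto
  with final_level caps x have "feasible_P N z"
    by (simp add: feasible_P_iff)
  moreover have "total_cost N z \<le> total_cost N x"
    unfolding total_cost_def
  proof (rule sum_mono)
    show "(\<Sum>t\<in>?T. gen_cost N i (generation z i t)) \<le> (\<Sum>t\<in>?T. gen_cost N i (generation x i t))" for i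
      using cost' by (simp add: z_def)
  qed
  moreover have "storage_cap z k = 0" by (simp add: z_def)
  moreover have "storage_cap z i = storage_cap x i" if "i \<noteq> k" "i \<noteq> l" for i
    using that by (simp add: z_def)
  ultimately show thesis by (rule that)
qed

section \<open>Emptying all buses of K and comparing the optimal values\<close>

text \<open>Induction over the finite set \<open>K\<close>: each step empties one more bus at no
  extra cost.\<close>

lemma feasible_Pi_no_costlier:
  assumes x: "feasible_P N x"
    and K: "K \<subseteq> gen_buses N" "\<And>k. k \<in> K \<Longrightarrow> single_connection N k"
  shows "\<exists>z. feasible_Pi N K z \<and> total_cost N z \<le> total_cost N x"
proof -
  have "finite K" using K(1) buses_partition finite_buses by (auto intro: finite_subset)
  then show ?thesis
    using K
  proof (induction rule: finite_induct)
    case empty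
    with x show ?case by (auto simp: feasible_Pi_def)
  next
    case (insert k J)
    then obtain y where y: "feasible_Pi N J y" "total_cost N y \<le> total_cost N x" by auto
    obtain l where l: "neighbors N k = {l}"
      using insert.prems(2)[of k] unfolding single_connection_def
      by (meson card_1_singletonE insertI1)
    \<comment> \<open>Hence the buses of \<open>J\<close>, already emptied, keep capacity 0 when
      \<open>k\<close> hands its storage to \<open>l\<close>.\<close>
    have "l \<notin> insert k J" using neighbor_not_single_generator[OF insert.prems _ l] by simp
    obtain z where z: "feasible_P N z" "total_cost N z \<le> total_cost N y" "storage_cap z k = 0"
      "\<And>i. i \<noteq> k \<Longrightarrow> i \<noteq> l \<Longrightarrow> storage_cap z i = storage_cap y i"
      using move_storage[OF _ _ l, of y] y(1) insert.prems(1)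
      by (auto simp: feasible_Pi_def)
    have "storage_cap z i = 0" if "i \<in> insert k J" for i
      using that z(3,4) y(1) \<open>l \<notin> insert k J\<close> 
      by (cases "i = k"; cases "i = l") (auto simp: feasible_Pi_def)
    with z y show ?case by (auto simp: feasible_Pi_def)
  qed
qed

end

theorem theorem1:
  fixes N :: network and K :: "nat set"
  assumes "storage_network N"
    and "K \<subseteq> gen_buses N"
    and "\<And>k. k \<in> K \<Longrightarrow> single_connection N k"
    and "\<exists>x. feasible_P N x"
  shows "(\<exists>x. feasible_Pi N K x) \<and> opt_P N = opt_Pi N K"
proof
  interpret storage_network N by fact
  note move = feasible_Pi_no_costlier[OF _ assms(2,3)]
  show "\<exists>x. feasible_Pi N K x" using assms(4) move by blast
  show "opt_P N = opt_Pi N K"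
  proof (rule antisym)
    show "opt_P N \<le> opt_Pi N K"
      unfolding opt_P_def opt_Pi_def
      by (rule INF_superset_mono) (auto simp: feasible_Pi_def)
    \<comment> \<open>Each feasible decision is matched by a restricted one that costs no more,
      which compares the infima whether or not they are attained.\<close>
    show "opt_Pi N K \<le> opt_P N"
      unfolding opt_P_def opt_Pi_def
      by (rule INF_mono) (use move in auto)
  qed
qed

end
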